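(* Assume that one evaluation of $f$ costs $T_f=O(1)$ queries. Then, for integers $1\le d\le n$, the query complexity of the problem $LRECW(f,n,d)$ (find an empty rectangle of width $d$ of the largest area, for $f:\{0,\dots,n-1\}\times\{0,\dots,n-1\}\to\{0,1\}$) is $\Omega(nd)$ in the classical (deterministic or randomized) case and $\Omega(\sqrt{nd})$ in the quantum case.
   Context: Given $f:\{0,\dots,n-1\}^2\to\{0,1\}$, a quadruple $(x_1,y_1,x_2,y_2)$ with $0\le x_1\le x_2\le n-1$ and $0\le y_1\le y_2\le n-1$ is an empty rectangle if $f(i,j)=0$ for all $x_1\le i\le x_2$, $y_1\le j\le y_2$. Its width is $x_2-x_1+1$ and its size (area) is $(x_2-x_1+1)(y_2-y_1+1)$. Problem $LRECW(f,n,d)$ (Largest Empty Rectangle with a Fixed Width): output an empty rectangle of width exactly $d$, i.e. of the form $(x_1,y_1,x_1+d-1,y_2)$, such that no empty rectangle of width $d$ has larger size (if there is no empty rectangle of width $d$, output $(NULL,NULL,NULL,NULL)$). Query model: the input is the table of values of $f$, and a query reveals one value $f(i,j)$. In the quantum case a query is one application of the unitary $|i,j\rangle|z\rangle|w\rangle\mapsto|i,j\rangle|z+f(i,j) \bmod 2\rangle|w\rangle$, interleaved with arbitrary input-independent unitaries and followed by a final measurement. The (randomized or quantum) query complexity of the problem is the smallest worst-case number of queries of an algorithm that, on every input, outputs a correct answer with probability at least $2/3$. *)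

theory Defs
  imports
    "HOL-Probability.Probability_Mass_Function"
    "HOL-Library.Landau_Symbols"
    "HOL-Library.Extended_Nat"
    "HOL-Library.Extended_Real"
begin

section \<open>Largest empty rectangle with a fixed width\<close>

type_synonym cell = "nat \<times> nat"
type_synonym rectangle = "nat \<times> nat \<times> nat \<times> nat"

text \<open>An answer is a rectangle or \<open>None\<close>, which stands for the all-NULL quadruple.\<close>
type_synonym answer = "rectangle option"

definition grid :: "nat \<Rightarrow> cell set" where
  "grid n = {..<n} \<times> {..<n}"

definition inputs :: "nat \<Rightarrow> (cell \<Rightarrow> nat) set" where
  "inputs n = grid n \<rightarrow>\<^sub>E {0, 1}"

fun empty_rectangle :: "nat \<Rightarrow> (cell \<Rightarrow> nat) \<Rightarrow> rectangle \<Rightarrow> bool" where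
  "empty_rectangle n f (x1, y1, x2, y2) \<longleftrightarrow>
     x1 \<le> x2 \<and> x2 < n \<and> y1 \<le> y2 \<and> y2 < n \<and>
     (\<forall>i\<in>{x1..x2}. \<forall>j\<in>{y1..y2}. f (i, j) = 0)"

fun width :: "rectangle \<Rightarrow> nat" where
  "width (x1, y1, x2, y2) = x2 - x1 + 1"

fun area :: "rectangle \<Rightarrow> nat" where
  "area (x1, y1, x2, y2) = (x2 - x1 + 1) * (y2 - y1 + 1)"

definition LRECW :: "(cell \<Rightarrow> nat) \<Rightarrow> nat \<Rightarrow> nat \<Rightarrow> answer \<Rightarrow> bool" where
  "LRECW f n d a = (case a of
     Some r \<Rightarrow> empty_rectangle n f r \<and> width r = d \<and>
       (\<forall>r'. empty_rectangle n f r' \<and> width r' = d \<longrightarrow> area r' \<le> area r)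
   | None \<Rightarrow> \<not> (\<exists>r. empty_rectangle n f r \<and> width r = d))"


section \<open>Classical query algorithms\<close>

text \<open>\<open>Query p t0 t1\<close> evaluates the input at \<open>p\<close> and continues with \<open>t0\<close> if the value is 0
  and with \<open>t1\<close> otherwise.\<close>
datatype decision_tree =
    Output answer
  | Query cell decision_tree decision_tree

primrec queried_cells :: "decision_tree \<Rightarrow> cell set" where
  "queried_cells (Output a) = {}"
| "queried_cells (Query p t0 t1) = insert p (queried_cells t0 \<union> queried_cells t1)"

primrec run :: "decision_tree \<Rightarrow> (cell \<Rightarrow> nat) \<Rightarrow> answer" where
  "run (Output a) f = a"
| "run (Query p t0 t1) f = (if f p = 0 then run t0 f else run t1 f)"

primrec evaluations :: "decision_tree \<Rightarrow> (cell \<Rightarrow> nat) \<Rightarrow> nat" where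
  "evaluations (Output a) f = 0"
| "evaluations (Query p t0 t1) f = Suc (if f p = 0 then evaluations t0 f else evaluations t1 f)"

definition decision_trees :: "nat \<Rightarrow> decision_tree set" where
  "decision_trees n = {t. queried_cells t \<subseteq> grid n}"

definition deterministic_solves :: "nat \<Rightarrow> nat \<Rightarrow> decision_tree \<Rightarrow> bool" where
  "deterministic_solves n d t \<longleftrightarrow>
     t \<in> decision_trees n \<and> (\<forall>f\<in>inputs n. LRECW f n d (run t f))"

text \<open>In all three complexity measures below \<open>T\<close> is the number of queries charged for one
  evaluation of \<open>f\<close>. With \<open>T = 1\<close> they count the evaluations themselves.
  The infimum over the empty set of algorithms would be \<open>\<infinity>\<close>.\<close>

definition deterministic_query_complexity :: "nat \<Rightarrow> nat \<Rightarrow> nat \<Rightarrow> enat" where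
  "deterministic_query_complexity T n d =
     (INF t\<in>{t. deterministic_solves n d t}. SUP f\<in>inputs n. enat (T * evaluations t f))"

text \<open>A randomized algorithm draws a decision tree at random, independently of the input. Its
  worst-case number of queries is taken over both the inputs and the random choices.\<close>

definition randomized_solves :: "nat \<Rightarrow> nat \<Rightarrow> decision_tree pmf \<Rightarrow> bool" where
  "randomized_solves n d A \<longleftrightarrow>
     set_pmf A \<subseteq> decision_trees n \<and>
     (\<forall>f\<in>inputs n. measure_pmf.prob A {t. LRECW f n d (run t f)} \<ge> 2 / 3)"

definition randomized_query_complexity :: "nat \<Rightarrow> nat \<Rightarrow> nat \<Rightarrow> enat" where
  "randomized_query_complexity T n d =
     (INF A\<in>{A. randomized_solves n d A}.
        SUP t\<in>set_pmf A. SUP f\<in>inputs n. enat (T * evaluations t f))"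


section \<open>Quantum query algorithms\<close>

text \<open>The basis state \<open>(i, j, z, w)\<close> stands for |i,j>|z>|w>. The work register has
  an arbitrary finite dimension \<open>m\<close>. States are amplitude functions and operators are
  matrices indexed by (row, column); only their values on \<open>basis n m\<close> matter.\<close>

type_synonym basis_state = "nat \<times> nat \<times> nat \<times> nat"
type_synonym qstate = "basis_state \<Rightarrow> complex"
type_synonym qoperator = "basis_state \<Rightarrow> basis_state \<Rightarrow> complex"

definition basis :: "nat \<Rightarrow> nat \<Rightarrow> basis_state set" where
  "basis n m = {..<n} \<times> {..<n} \<times> {..<2} \<times> {..<m}"

definition apply_op :: "basis_state set \<Rightarrow> qoperator \<Rightarrow> qstate \<Rightarrow> qstate" where
  "apply_op B U \<psi> = (\<lambda>a. \<Sum>b\<in>B. U a b * \<psi> b)"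

definition unitary_on :: "basis_state set \<Rightarrow> qoperator \<Rightarrow> bool" where
  "unitary_on B U \<longleftrightarrow>
     (\<forall>a\<in>B. \<forall>b\<in>B. (\<Sum>c\<in>B. cnj (U c a) * U c b) = (if a = b then 1 else 0)) \<and>
     (\<forall>a\<in>B. \<forall>b\<in>B. (\<Sum>c\<in>B. U a c * cnj (U b c)) = (if a = b then 1 else 0))"

fun query_map :: "(cell \<Rightarrow> nat) \<Rightarrow> basis_state \<Rightarrow> basis_state" where
  "query_map f (i, j, z, w) = (i, j, (z + f (i, j)) mod 2, w)"

definition query_op :: "(cell \<Rightarrow> nat) \<Rightarrow> qoperator" where
  "query_op f a b = (if a = query_map f b then 1 else 0)"

text \<open>The algorithm applies \<open>initial_op\<close> to the basis state \<open>(0, 0, 0, 0)\<close> and then, for each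
  operator in \<open>later_ops\<close>, one query followed by that operator. Finally it measures in the
  computational basis and maps the outcome to an answer by \<open>readout\<close>.\<close>
record quantum_algorithm =
  work_dim :: nat
  initial_op :: qoperator
  later_ops :: "qoperator list"
  readout :: "basis_state \<Rightarrow> answer"

definition quantum_algorithms :: "nat \<Rightarrow> quantum_algorithm set" where
  "quantum_algorithms n = {Q. work_dim Q \<ge> 1 \<and>
     (\<forall>U\<in>insert (initial_op Q) (set (later_ops Q)). unitary_on (basis n (work_dim Q)) U)}"

definition initial_state :: qstate where
  "initial_state = (\<lambda>b. if b = (0, 0, 0, 0) then 1 else 0)"

definition final_state :: "nat \<Rightarrow> quantum_algorithm \<Rightarrow> (cell \<Rightarrow> nat) \<Rightarrow> qstate" where
  "final_state n Q f = (let B = basis n (work_dim Q) in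
     fold (\<lambda>U \<psi>. apply_op B U (apply_op B (query_op f) \<psi>)) (later_ops Q)
       (apply_op B (initial_op Q) initial_state))"

definition success_probability ::
    "nat \<Rightarrow> nat \<Rightarrow> quantum_algorithm \<Rightarrow> (cell \<Rightarrow> nat) \<Rightarrow> real" where
  "success_probability n d Q f =
     (\<Sum>b\<in>{b\<in>basis n (work_dim Q). LRECW f n d (readout Q b)}. (cmod (final_state n Q f b))\<^sup>2)"

definition quantum_solves :: "nat \<Rightarrow> nat \<Rightarrow> quantum_algorithm \<Rightarrow> bool" where
  "quantum_solves n d Q \<longleftrightarrow>
     Q \<in> quantum_algorithms n \<and> (\<forall>f\<in>inputs n. success_probability n d Q f \<ge> 2 / 3)"

definition quantum_query_complexity :: "nat \<Rightarrow> nat \<Rightarrow> nat \<Rightarrow> enat" where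
  "quantum_query_complexity T n d =
     (INF Q\<in>{Q. quantum_solves n d Q}. enat (T * length (later_ops Q)))"

end

theory Submission
  imports Defs
begin

text \<open>The input that is 0 exactly on the strip of the first \<open>d\<close> columns has a unique correct
  answer, namely the whole strip, and this answer becomes wrong as soon as one of the \<open>n * d\<close> cells
  of the strip is flipped. So an algorithm has to tell the zero strip from every strip with a single 1,
  as in unstructured search. Classically each cell of the strip must be
  queried with probability at least \<open>1 / 3\<close>. In the quantum case the hybrid argument of Bennett,
  Bernstein, Brassard and Vazirani bounds the distance between the two final states by the query
  weight on the flipped cell, and the weights sum to at most 1 for each query.\<close>

section \<open>The hard inputs\<close>

definition strip :: "nat \<Rightarrow> nat \<Rightarrow> cell set" where
  "strip n d = {..<d} \<times> {..<n}"

text \<open>Restricting the function to \<open>grid n\<close> makes it extensional, as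
  \<open>inputs\<close> demands. The ones beyond the strip confine every empty rectangle to the
  first \<open>d\<close> columns.\<close>

definition strip_input :: "nat \<Rightarrow> nat \<Rightarrow> cell \<Rightarrow> nat" where
  "strip_input n d = (\<lambda>p\<in>grid n. if fst p < d then 0 else 1)"

definition strip_answer :: "nat \<Rightarrow> nat \<Rightarrow> answer" where
  "strip_answer n d = Some (0, 0, d - 1, n - 1)"

lemma finite_strip: "finite (strip n d)"
  and card_strip: "card (strip n d) = n * d"
  by (simp_all add: strip_def)

lemma strip_subset_grid: "d \<le> n \<Longrightarrow> strip n d \<subseteq> grid n"
  by (auto simp: strip_def grid_def)

lemma strip_input_in_inputs: "strip_input n d \<in> inputs n"
  by (auto simp: strip_input_def inputs_def)

lemma flipped_strip_input_in_inputs: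
  assumes "d \<le> n" "p \<in> strip n d"
  shows "(strip_input n d)(p := 1) \<in> inputs n"
  using assms strip_subset_grid[of d n]
  by (auto simp: strip_input_def inputs_def PiE_def extensional_def)

text \<open>Maximality against the whole strip, of area \<open>d * n\<close>, forces height
  \<open>n\<close>. The zeros end before column \<open>d\<close>, so width \<open>d\<close> leaves
  room for one horizontal position only.\<close>

lemma LRECW_strip_input:
  assumes "1 \<le> d" "d \<le> n" "LRECW (strip_input n d) n d a"
  shows "a = strip_answer n d"
proof -
  have whole: "empty_rectangle n (strip_input n d) (0, 0, d - 1, n - 1)"
    "width (0, 0, d - 1, n - 1) = d"
    using assms(1,2) by (auto simp: strip_input_def grid_def)
  obtain r where a: "a = Some r"
  proof (cases a)
    case None
    have "\<not> (\<exists>r. empty_rectangle n (strip_input n d) r \<and> width r = d)"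
      using assms(3) unfolding LRECW_def None option.case .
    then show ?thesis
      using whole by blast
  qed
  then have r: "empty_rectangle n (strip_input n d) r" "width r = d"
    "area (0, 0, d - 1, n - 1) \<le> area r"
    using assms(3) whole unfolding LRECW_def a option.case by blast+
  obtain x1 y1 x2 y2 where r_eq: "r = (x1, y1, x2, y2)"
    by (metis prod.exhaust)
  have e: "empty_rectangle n (strip_input n d) (x1, y1, x2, y2)"
    and w: "x2 - x1 + 1 = d"
    and "area (0, 0, d - 1, n - 1) \<le> area (x1, y1, x2, y2)"
    using r unfolding r_eq by simp_all
  then have "d * n \<le> d * (y2 - y1 + 1)"
    using assms(1,2) by simp
  then have "n \<le> y2 - y1 + 1"
    using assms(1) unfolding mult_le_cancel1 by linarith
  moreover have "y2 < n" "y1 \<le> y2" "x1 \<le> x2" "x2 < n"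
    using e by auto
  \<comment> \<open>The last column suffices: \<open>x2 < d\<close> and
    \<open>x2 - x1 + 1 = d\<close> give \<open>x1 = 0\<close> and \<open>x2 = d - 1\<close>.\<close>
  moreover have "strip_input n d (x2, y2) = 0"
    using e by simp
  then have "x2 < d"
    using \<open>y2 < n\<close> \<open>x2 < n\<close> by (auto simp: strip_input_def grid_def split: if_splits)
  ultimately show ?thesis
    using w by (auto simp: a r_eq strip_answer_def)
qed

lemma not_LRECW_flipped_strip_input:
  assumes "p \<in> strip n d"
  shows "\<not> LRECW ((strip_input n d)(p := 1)) n d (strip_answer n d)"
proof
  obtain i j where p: "p = (i, j)" "i < d" "j < n"
    using assms by (auto simp: strip_def)
  assume "LRECW ((strip_input n d)(p := 1)) n d (strip_answer n d)"
  then have "empty_rectangle n ((strip_input n d)(p := 1)) (0, 0, d - 1, n - 1)"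
    unfolding LRECW_def strip_answer_def option.case by blast
  then have "\<forall>i'\<in>{0..d - 1}. \<forall>j'\<in>{0..n - 1}. ((strip_input n d)(p := 1)) (i', j') = 0"
    unfolding empty_rectangle.simps by blast
  \<comment> \<open>The cell \<open>(i, j)\<close> witnesses that \<open>d\<close> and
    \<open>n\<close> are positive, so the subtractions are not truncated.\<close>
  moreover have "i \<in> {0..d - 1}" "j \<in> {0..n - 1}"
    using p by auto
  ultimately have "((strip_input n d)(p := 1)) (i, j) = 0"
    by blast
  then show False
    using p(1) by simp
qed

section \<open>Classical algorithms\<close>

text \<open>Unlike \<open>queried_cells\<close>, this follows only the branch taken on
  \<open>f\<close>, which is all that the run can learn about \<open>f\<close>.\<close>

primrec path_cells :: "decision_tree \<Rightarrow> (cell \<Rightarrow> nat) \<Rightarrow> cell set" where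
  "path_cells (Output a) f = {}"
| "path_cells (Query p t0 t1) f =
     insert p (if f p = 0 then path_cells t0 f else path_cells t1 f)"

lemma finite_path_cells: "finite (path_cells t f)"
  by (induction t) auto

text \<open>Only an inequality, since a tree may query a cell repeatedly.\<close>

lemma card_path_cells_le: "card (path_cells t f) \<le> evaluations t f"
  by (induction t) (auto intro: order.trans[OF card_insert_le_m1] simp: card_insert_if finite_path_cells)

lemma run_eq_if_agree_on_path:
  assumes "\<forall>p\<in>path_cells t f. f p = g p"
  shows "run t f = run t g"
  using assms by (induction t) (auto split: if_splits)

text \<open>A tree that does not query \<open>p\<close> answers alike on both inputs, so it errs on
  one of them. Each error has probability at most \<open>1 / 3\<close>, so trees that are right on
  both have probability at least \<open>1 / 3\<close>.\<close>

lemma randomized_query_prob_ge: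
  assumes "1 \<le> d" "d \<le> n" "randomized_solves n d A" "p \<in> strip n d"
  shows "1 / 3 \<le> measure_pmf.prob A {t. p \<in> path_cells t (strip_input n d)}"
proof -
  let ?f = "strip_input n d"
  let ?X = "{t. LRECW ?f n d (run t ?f)}"
  let ?Y = "{t. LRECW (?f(p := 1)) n d (run t (?f(p := 1)))}"
  let ?Z = "{t. p \<in> path_cells t ?f}"
  have "?X \<subseteq> (UNIV - ?Y) \<union> ?Z"
  proof
    fix t assume t: "t \<in> ?X"
    show "t \<in> (UNIV - ?Y) \<union> ?Z"
    proof (cases "p \<in> path_cells t ?f")
      case False
      then have "run t ?f = run t (?f(p := 1))"
        by (intro run_eq_if_agree_on_path) auto
      then show ?thesis
        using t LRECW_strip_input[OF assms(1,2)] not_LRECW_flipped_strip_input[OF assms(4)] by auto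
    qed simp
  qed
  then have "measure_pmf.prob A ?X \<le> measure_pmf.prob A ((UNIV - ?Y) \<union> ?Z)"
    by (intro measure_pmf.finite_measure_mono) auto
  also have "\<dots> \<le> measure_pmf.prob A (UNIV - ?Y) + measure_pmf.prob A ?Z"
    by (intro measure_Un_le) auto
  also have "measure_pmf.prob A (UNIV - ?Y) = 1 - measure_pmf.prob A ?Y"
    using measure_pmf.prob_compl[of ?Y A] by simp
  finally have "measure_pmf.prob A ?X + measure_pmf.prob A ?Y \<le> 1 + measure_pmf.prob A ?Z"
    by simp
  moreover have "2 / 3 \<le> measure_pmf.prob A ?X" "2 / 3 \<le> measure_pmf.prob A ?Y"
    using assms(3) strip_input_in_inputs[of n d] flipped_strip_input_in_inputs[OF assms(2,4)]
    unfolding randomized_solves_def by blast+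
  ultimately show ?thesis
    by linarith
qed

text \<open>Double counting: the query probabilities of the strip cells add up to the expected
  number of distinct strip cells queried, which is at most \<open>K\<close>.\<close>

lemma randomized_evaluations_ge:
  assumes "1 \<le> d" "d \<le> n" "randomized_solves n d A"
    and K: "\<And>t. t \<in> set_pmf A \<Longrightarrow> evaluations t (strip_input n d) \<le> K"
  shows "1 / 3 * real (n * d) \<le> real K"
proof -
  let ?f = "strip_input n d"
  let ?Z = "\<lambda>p. {t. p \<in> path_cells t ?f}"
  have "1 / 3 * real (n * d) = (\<Sum>p\<in>strip n d. 1 / 3)"
    by (simp add: card_strip)
  also have "\<dots> \<le> (\<Sum>p\<in>strip n d. measure_pmf.prob A (?Z p))"
    by (intro sum_mono randomized_query_prob_ge assms)
  \<comment> \<open>Linearity of expectation.\<close>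
  also have "\<dots> = (\<integral>t. (\<Sum>p\<in>strip n d. indicator (?Z p) t) \<partial>measure_pmf A)"
    by (subst Bochner_Integration.integral_sum)
      (auto intro!: measure_pmf.integrable_const_bound[where B = 1] AE_pmfI)
  also have "\<dots> \<le> real K"
  proof (rule measure_pmf.integral_le_const)
    show "integrable (measure_pmf A) (\<lambda>t. \<Sum>p\<in>strip n d. indicator (?Z p) t :: real)"
      by (auto intro!: Bochner_Integration.integrable_sum
          measure_pmf.integrable_const_bound[where B = 1] AE_pmfI)
    show "AE t in measure_pmf A. (\<Sum>p\<in>strip n d. indicator (?Z p) t) \<le> real K"
    proof (rule AE_pmfI)
      fix t assume "t \<in> set_pmf A"
      have "(\<Sum>p\<in>strip n d. indicator (?Z p) t :: real) = (\<Sum>p\<in>strip n d. indicator (path_cells t ?f) p)"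
        by (intro sum.cong) (auto simp: indicator_def)
      also have "\<dots> = real (card (strip n d \<inter> path_cells t ?f))"
        by (simp add: indicator_def sum_of_bool_eq finite_strip Int_def)
      also have "card (strip n d \<inter> path_cells t ?f) \<le> evaluations t ?f"
        using card_mono[OF finite_path_cells, of "strip n d \<inter> path_cells t ?f"]
          card_path_cells_le[of t ?f] by (metis inf_le2 order.trans)
      finally show "(\<Sum>p\<in>strip n d. indicator (?Z p) t) \<le> real K"
        using K[OF \<open>t \<in> set_pmf A\<close>] by linarith
    qed
  qed
  finally show ?thesis .
qed

lemma deterministic_solves_imp_randomized_solves:
  "deterministic_solves n d t \<Longrightarrow> randomized_solves n d (return_pmf t)"
  by (auto simp: deterministic_solves_def randomized_solves_def indicator_def)

section \<open>Quantum algorithms\<close>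

text \<open>The set is a parameter because norms of projections onto subsets of the basis are needed
  too.\<close>

definition state_norm :: "basis_state set \<Rightarrow> qstate \<Rightarrow> real" where
  "state_norm B \<psi> = L2_set (\<lambda>b. cmod (\<psi> b)) B"

text \<open>The squared \<open>state_norm\<close> over this set is the query weight of a state on
  the cell \<open>p\<close>.\<close>

definition cell_basis :: "nat \<Rightarrow> nat \<Rightarrow> cell \<Rightarrow> basis_state set" where
  "cell_basis n m p = {b \<in> basis n m. (fst b, fst (snd b)) = p}"

text \<open>With the operator list as an argument, prefixes of it give the intermediate
  states.\<close>

definition evolve :: "nat \<Rightarrow> nat \<Rightarrow> (cell \<Rightarrow> nat) \<Rightarrow> qoperator list \<Rightarrow> qstate \<Rightarrow> qstate" where
  "evolve n m f Us = fold (\<lambda>U \<psi>. apply_op (basis n m) U (apply_op (basis n m) (query_op f) \<psi>)) Us"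

lemma final_state_eq_evolve:
  "final_state n Q f = evolve n (work_dim Q) f (later_ops Q)
     (apply_op (basis n (work_dim Q)) (initial_op Q) initial_state)"
  by (simp add: final_state_def evolve_def Let_def)

lemma finite_basis: "finite (basis n m)"
  by (simp add: basis_def)

section \<open>Norms of states and their invariance under unitaries\<close>

lemma state_norm_nonneg: "0 \<le> state_norm B \<psi>"
  by (simp add: state_norm_def)

lemma state_norm_sq: "(state_norm B \<psi>)\<^sup>2 = (\<Sum>b\<in>B. (cmod (\<psi> b))\<^sup>2)"
  by (simp add: state_norm_def L2_set_def sum_nonneg)

lemma state_norm_cong: "(\<And>b. b \<in> B \<Longrightarrow> \<phi> b = \<psi> b) \<Longrightarrow> state_norm B \<phi> = state_norm B \<psi>"
  by (auto simp: state_norm_def intro: L2_set_cong)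

lemma state_norm_triangle:
  "state_norm B (\<lambda>b. \<phi> b + \<psi> b) \<le> state_norm B \<phi> + state_norm B \<psi>"
proof -
  have "state_norm B (\<lambda>b. \<phi> b + \<psi> b) \<le> L2_set (\<lambda>b. cmod (\<phi> b) + cmod (\<psi> b)) B"
    unfolding state_norm_def by (intro L2_set_mono norm_triangle_ineq) auto
  also have "\<dots> \<le> state_norm B \<phi> + state_norm B \<psi>"
    unfolding state_norm_def by (rule L2_set_triangle_ineq)
  finally show ?thesis .
qed

lemma state_norm_minus: "state_norm B (\<lambda>b. \<phi> b - \<psi> b) = state_norm B (\<lambda>b. \<psi> b - \<phi> b)"
  by (simp add: state_norm_def norm_minus_commute)

lemma state_norm_triangle_diff:
  "state_norm B (\<lambda>b. \<phi> b - \<psi> b) \<le> state_norm B \<phi> + state_norm B \<psi>"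
  using state_norm_triangle[of B \<phi> "\<lambda>b. - \<psi> b"] by (simp add: state_norm_def)

lemma state_norm_mono_set:
  assumes "finite B" "A \<subseteq> B"
  shows "state_norm A \<psi> \<le> state_norm B \<psi>"
  unfolding state_norm_def L2_set_def
  by (intro real_sqrt_le_mono sum_mono2 assms) auto

lemma state_norm_reindex:
  assumes "bij_betw h B B"
  shows "state_norm B (\<lambda>b. \<psi> (h b)) = state_norm B \<psi>"
  using sum.reindex_bij_betw[OF assms, of "\<lambda>b. (cmod (\<psi> b))\<^sup>2"]
  by (simp add: state_norm_def L2_set_def)

lemma apply_op_diff:
  "apply_op B U (\<lambda>b. \<phi> b - \<psi> b) = (\<lambda>b. apply_op B U \<phi> b - apply_op B U \<psi> b)"
  by (simp add: apply_op_def algebra_simps sum_subtractf)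

lemma state_norm_unitary:
  assumes "unitary_on B U" "finite B"
  shows "state_norm B (apply_op B U \<psi>) = state_norm B \<psi>"
proof -
  have "complex_of_real (\<Sum>a\<in>B. (cmod (apply_op B U \<psi> a))\<^sup>2)
      = (\<Sum>a\<in>B. cnj (apply_op B U \<psi> a) * apply_op B U \<psi> a)"
    by (simp add: complex_norm_square mult.commute del: of_real_power)
  also have "\<dots> = (\<Sum>a\<in>B. \<Sum>b\<in>B. \<Sum>c\<in>B. cnj (U a b) * U a c * (cnj (\<psi> b) * \<psi> c))"
    by (simp add: apply_op_def sum_product) (simp add: mult_ac)
  also have "\<dots> = (\<Sum>b\<in>B. \<Sum>a\<in>B. \<Sum>c\<in>B. cnj (U a b) * U a c * (cnj (\<psi> b) * \<psi> c))"
    by (rule sum.swap)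
  also have "\<dots> = (\<Sum>b\<in>B. \<Sum>c\<in>B. (\<Sum>a\<in>B. cnj (U a b) * U a c) * (cnj (\<psi> b) * \<psi> c))"
    by (simp add: sum_distrib_right) (rule sum.cong[OF refl], rule sum.swap)
  \<comment> \<open>The inner sum is the scalar product of two columns of \<open>U\<close>, which
    are orthonormal.\<close>
  also have "\<dots> = (\<Sum>b\<in>B. \<Sum>c\<in>B. (if b = c then 1 else 0) * (cnj (\<psi> b) * \<psi> c))"
    using assms(1) by (intro sum.cong refl) (simp add: unitary_on_def)
  also have "\<dots> = (\<Sum>b\<in>B. \<Sum>c\<in>B. if b = c then cnj (\<psi> b) * \<psi> c else 0)"
    by (intro sum.cong refl) simp
  also have "\<dots> = (\<Sum>b\<in>B. cnj (\<psi> b) * \<psi> b)"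
    using assms(2) by simp
  also have "\<dots> = complex_of_real (\<Sum>b\<in>B. (cmod (\<psi> b))\<^sup>2)"
    by (simp add: complex_norm_square mult.commute del: of_real_power)
  finally have "(\<Sum>a\<in>B. (cmod (apply_op B U \<psi> a))\<^sup>2) = (\<Sum>b\<in>B. (cmod (\<psi> b))\<^sup>2)"
    unfolding of_real_eq_iff .
  then show ?thesis
    by (simp add: state_norm_def L2_set_def)
qed

section \<open>The query operator as a permutation of the basis\<close>

lemma query_map_in_cell_basis: "b \<in> cell_basis n m p \<Longrightarrow> query_map f b \<in> cell_basis n m p"
  by (cases b) (auto simp: cell_basis_def basis_def)

lemma query_map_in_basis: "b \<in> basis n m \<Longrightarrow> query_map f b \<in> basis n m"
  by (cases b) (auto simp: basis_def)

lemma query_map_involution: "b \<in> basis n m \<Longrightarrow> query_map f (query_map f b) = b"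
proof (cases b)
  case (fields i j z w)
  assume "b \<in> basis n m"
  then have "z < 2" using fields by (auto simp: basis_def)
  then have "((z + f (i, j)) mod 2 + f (i, j)) mod 2 = z" by presburger
  then show ?thesis using fields by simp
qed

text \<open>Adding the same value twice modulo 2 restores the bit, so a query is its own inverse. It
  leaves the cell register alone and hence permutes each \<open>cell_basis\<close> as well.\<close>

lemma bij_betw_query_map:
  "bij_betw (query_map f) (basis n m) (basis n m)"
  "bij_betw (query_map f) (cell_basis n m p) (cell_basis n m p)"
  using query_map_in_basis query_map_in_cell_basis query_map_involution
  by (auto intro!: bij_betw_byWitness[where f' = "query_map f"] simp: cell_basis_def)

lemma apply_query_op:
  assumes "a \<in> basis n m"
  shows "apply_op (basis n m) (query_op f) \<psi> a = \<psi> (query_map f a)"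
proof -
  \<comment> \<open>The involution turns the condition \<open>a = query_map f b\<close> into one
    that determines \<open>b\<close>.\<close>
  have "apply_op (basis n m) (query_op f) \<psi> a
      = (\<Sum>b\<in>basis n m. if b = query_map f a then \<psi> b else 0)"
    unfolding apply_op_def query_op_def
    using query_map_involution[of _ n m f] assms by (intro sum.cong refl) auto
  then show ?thesis
    using query_map_in_basis[OF assms] by (simp add: finite_basis)
qed

lemma state_norm_query:
  "state_norm (basis n m) (apply_op (basis n m) (query_op f) \<psi>) = state_norm (basis n m) \<psi>"
proof -
  have "state_norm (basis n m) (apply_op (basis n m) (query_op f) \<psi>)
      = state_norm (basis n m) (\<lambda>b. \<psi> (query_map f b))"
    by (intro state_norm_cong apply_query_op)
  also have "\<dots> = state_norm (basis n m) \<psi>"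
    by (rule state_norm_reindex[OF bij_betw_query_map(1)])
  finally show ?thesis .
qed

lemma state_norm_evolve:
  assumes "\<forall>U\<in>set Us. unitary_on (basis n m) U"
  shows "state_norm (basis n m) (evolve n m f Us \<psi>) = state_norm (basis n m) \<psi>"
  using assms
  by (induction Us rule: rev_induct)
    (auto simp: evolve_def state_norm_unitary[OF _ finite_basis] state_norm_query)

section \<open>The hybrid argument\<close>

text \<open>The two queries agree on basis states with another cell, so the difference lives on
  \<open>cell_basis n m p\<close>. There both terms are permutations of \<open>\<psi>\<close>,
  whence the factor 2.\<close>

lemma state_norm_query_flip:
  assumes "\<And>q. q \<noteq> p \<Longrightarrow> f q = g q"
  shows "state_norm (basis n m) (\<lambda>b. apply_op (basis n m) (query_op f) \<psi> b
      - apply_op (basis n m) (query_op g) \<psi> b) \<le> 2 * state_norm (cell_basis n m p) \<psi>"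
proof -
  let ?D = "\<lambda>b. \<psi> (query_map f b) - \<psi> (query_map g b)"
  have zero: "?D b = 0" if "b \<in> basis n m - cell_basis n m p" for b
    using that assms by (cases b) (auto simp: cell_basis_def)
  have "state_norm (basis n m) (\<lambda>b. apply_op (basis n m) (query_op f) \<psi> b
      - apply_op (basis n m) (query_op g) \<psi> b) = state_norm (basis n m) ?D"
    by (intro state_norm_cong) (simp add: apply_query_op)
  also have "\<dots> = state_norm (cell_basis n m p) ?D"
    unfolding state_norm_def L2_set_def
    using zero by (intro arg_cong[where f = sqrt] sum.mono_neutral_right finite_basis)
      (auto simp: cell_basis_def)
  also have "\<dots> \<le> state_norm (cell_basis n m p) (\<lambda>b. \<psi> (query_map f b))
      + state_norm (cell_basis n m p) (\<lambda>b. \<psi> (query_map g b))"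
    by (rule state_norm_triangle_diff)
  also have "\<dots> = 2 * state_norm (cell_basis n m p) \<psi>"
    by (simp add: state_norm_reindex[OF bij_betw_query_map(2)])
  finally show ?thesis .
qed

text \<open>Each query adds at most the error of one wrong query applied to the
  \<open>g\<close>-state; errors made earlier are carried on by norm-preserving maps. The bound
  refers to the \<open>g\<close>-run alone, so one run can serve for all \<open>p\<close>.\<close>

lemma hybrid_bound:
  assumes "\<And>q. q \<noteq> p \<Longrightarrow> f q = g q" "\<forall>U\<in>set Us. unitary_on (basis n m) U"
  shows "state_norm (basis n m) (\<lambda>b. evolve n m f Us \<psi> b - evolve n m g Us \<psi> b)
    \<le> (\<Sum>s<length Us. 2 * state_norm (cell_basis n m p) (evolve n m g (take s Us) \<psi>))"
  using assms(2)
proof (induction Us rule: rev_induct)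
  case Nil
  then show ?case by (simp add: evolve_def state_norm_def L2_set_def)
next
  case (snoc U Us)
  let ?B = "basis n m"
  let ?O = "\<lambda>f. apply_op ?B (query_op f)"
  let ?\<phi> = "evolve n m f Us \<psi>" and ?\<chi> = "evolve n m g Us \<psi>"
  have "state_norm ?B (\<lambda>b. evolve n m f (Us @ [U]) \<psi> b - evolve n m g (Us @ [U]) \<psi> b)
      = state_norm ?B (apply_op ?B U (\<lambda>b. ?O f ?\<phi> b - ?O g ?\<chi> b))"
    by (simp add: evolve_def apply_op_diff)
  also have "\<dots> = state_norm ?B (\<lambda>b. ?O f ?\<phi> b - ?O g ?\<chi> b)"
    using snoc.prems by (simp add: state_norm_unitary[OF _ finite_basis])
  \<comment> \<open>The hybrid term \<open>?O f ?\<chi>\<close> is subtracted and added, separating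
    the old error from the new one.\<close>
  also have "\<dots> = state_norm ?B (\<lambda>b. ?O f (\<lambda>b. ?\<phi> b - ?\<chi> b) b + (?O f ?\<chi> b - ?O g ?\<chi> b))"
    by (simp add: apply_op_diff)
  also have "\<dots> \<le> state_norm ?B (?O f (\<lambda>b. ?\<phi> b - ?\<chi> b))
      + state_norm ?B (\<lambda>b. ?O f ?\<chi> b - ?O g ?\<chi> b)"
    by (rule state_norm_triangle)
  also have "\<dots> \<le> state_norm ?B (\<lambda>b. ?\<phi> b - ?\<chi> b) + 2 * state_norm (cell_basis n m p) ?\<chi>"
    using state_norm_query_flip[OF assms(1)] by (simp add: state_norm_query)
  finally show ?case
    using snoc by simp
qed

text \<open>The sets \<open>cell_basis n m p\<close> partition the basis as \<open>p\<close> runs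
  over the grid, so the squared norms add up.\<close>

lemma sum_cell_weights_le:
  assumes "S \<subseteq> grid n"
  shows "(\<Sum>p\<in>S. (state_norm (cell_basis n m p) \<psi>)\<^sup>2) \<le> (state_norm (basis n m) \<psi>)\<^sup>2"
proof -
  have "(\<Sum>p\<in>S. (state_norm (cell_basis n m p) \<psi>)\<^sup>2)
      \<le> (\<Sum>p\<in>grid n. (state_norm (cell_basis n m p) \<psi>)\<^sup>2)"
    using assms by (intro sum_mono2) (auto simp: grid_def)
  also have "\<dots> = (state_norm (basis n m) \<psi>)\<^sup>2"
    unfolding state_norm_sq cell_basis_def
    by (intro sum.group finite_basis) (auto simp: grid_def basis_def)
  finally show ?thesis .
qed

section \<open>Separation of the final states and the number of quantum queries\<close>

lemma state_norm_final_state: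
  assumes "Q \<in> quantum_algorithms n" "1 \<le> n"
  shows "state_norm (basis n (work_dim Q)) (final_state n Q f) = 1"
proof -
  have "(0, 0, 0, 0) \<in> basis n (work_dim Q)"
    using assms by (auto simp: quantum_algorithms_def basis_def)
  then have "state_norm (basis n (work_dim Q)) initial_state = 1"
    by (simp add: state_norm_def L2_set_def initial_state_def if_distrib[of cmod]
        if_distrib[of "\<lambda>x. x\<^sup>2"] finite_basis cong: if_cong)
  then show ?thesis
    using assms by (simp add: final_state_eq_evolve state_norm_evolve
        state_norm_unitary[OF _ finite_basis] quantum_algorithms_def)
qed

text \<open>Projected onto the outcomes read as the strip answer, the final state has norm at least
  \<open>sqrt (2 / 3)\<close> on the strip input and at most \<open>sqrt (1 / 3)\<close> on the
  flipped one.\<close>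

lemma final_states_far:
  assumes "1 \<le> d" "d \<le> n" "quantum_solves n d Q" "p \<in> strip n d"
  shows "1 / 5 \<le> state_norm (basis n (work_dim Q))
    (\<lambda>b. final_state n Q ((strip_input n d)(p := 1)) b - final_state n Q (strip_input n d) b)"
proof -
  let ?B = "basis n (work_dim Q)"
  let ?f = "strip_input n d" and ?g = "(strip_input n d)(p := 1)"
  let ?\<phi> = "final_state n Q ?f" and ?\<chi> = "final_state n Q ?g"
  let ?S = "{b \<in> ?B. readout Q b = strip_answer n d}"
  have Q: "Q \<in> quantum_algorithms n"
    using assms(3) by (simp add: quantum_solves_def)
  have "2 / 3 \<le> success_probability n d Q ?f"
    using assms(3) strip_input_in_inputs by (auto simp: quantum_solves_def)
  also have "\<dots> \<le> (state_norm ?S ?\<phi>)\<^sup>2"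
    unfolding success_probability_def state_norm_sq
    using LRECW_strip_input[OF assms(1,2)] by (intro sum_mono2) (auto simp: finite_basis)
  finally have f: "sqrt (2 / 3) \<le> state_norm ?S ?\<phi>"
    by (simp add: real_le_lsqrt state_norm_nonneg)
  have "2 / 3 \<le> success_probability n d Q ?g"
    using assms(3) flipped_strip_input_in_inputs[OF assms(2,4)] by (auto simp: quantum_solves_def)
  also have "\<dots> \<le> (\<Sum>b\<in>?B - ?S. (cmod (?\<chi> b))\<^sup>2)"
    unfolding success_probability_def
    using not_LRECW_flipped_strip_input[OF assms(4)] by (intro sum_mono2) (auto simp: finite_basis)
  also have "\<dots> = (state_norm ?B ?\<chi>)\<^sup>2 - (state_norm ?S ?\<chi>)\<^sup>2"
    unfolding state_norm_sq by (intro sum_diff finite_basis) auto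
  also have "state_norm ?B ?\<chi> = 1"
    using assms(1,2) by (intro state_norm_final_state[OF Q]) simp
  finally have g: "state_norm ?S ?\<chi> \<le> sqrt (1 / 3)"
    by (intro real_le_rsqrt) (unfold one_power2, linarith)
  have "state_norm ?S ?\<phi> \<le> state_norm ?S ?\<chi> + state_norm ?S (\<lambda>b. ?\<phi> b - ?\<chi> b)"
    using state_norm_triangle[of ?S ?\<chi> "\<lambda>b. ?\<phi> b - ?\<chi> b"] by simp
  also have "state_norm ?S (\<lambda>b. ?\<phi> b - ?\<chi> b) \<le> state_norm ?B (\<lambda>b. ?\<phi> b - ?\<chi> b)"
    by (intro state_norm_mono_set finite_basis) auto
  also have "\<dots> = state_norm ?B (\<lambda>b. ?\<chi> b - ?\<phi> b)"
    by (rule state_norm_minus)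
  finally have "sqrt (2 / 3) - sqrt (1 / 3) \<le> state_norm ?B (\<lambda>b. ?\<chi> b - ?\<phi> b)"
    using f g by linarith
  \<comment> \<open>Rational bounds with gap \<open>1 / 5\<close>:
    \<open>16 / 25 \<le> 2 / 3\<close> and \<open>1 / 3 \<le> 9 / 25\<close>.\<close>
  moreover have "4 / 5 \<le> sqrt (2 / 3)"
    by (intro real_le_rsqrt) (simp add: power2_eq_square)
  moreover have "sqrt (1 / 3) \<le> 3 / 5"
    by (intro real_le_lsqrt) (simp_all add: power2_eq_square)
  ultimately show ?thesis
    by linarith
qed

text \<open>Summing over the \<open>n * d\<close> cells turns the per-cell bound
  \<open>1 / 100\<close> into \<open>n * d / 100 \<le> q * q\<close>, where \<open>q\<close> is the
  number of queries, since each query has total weight at most 1.\<close>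

lemma quantum_queries_ge:
  assumes "1 \<le> d" "d \<le> n" "quantum_solves n d Q"
  shows "1 / 10 * sqrt (real (n * d)) \<le> real (length (later_ops Q))"
proof -
  let ?m = "work_dim Q" and ?f = "strip_input n d" and ?Us = "later_ops Q"
  let ?q = "length ?Us" and ?S = "strip n d"
  let ?\<psi> = "apply_op (basis n ?m) (initial_op Q) initial_state"
  let ?w = "\<lambda>s p. state_norm (cell_basis n ?m p) (evolve n ?m ?f (take s ?Us) ?\<psi>)"
  have Q: "Q \<in> quantum_algorithms n"
    using assms(3) by (simp add: quantum_solves_def)
  then have unitary: "unitary_on (basis n ?m) (initial_op Q)" "\<forall>U\<in>set ?Us. unitary_on (basis n ?m) U"
    by (auto simp: quantum_algorithms_def)
  have "1 / 100 \<le> real ?q * (\<Sum>s<?q. (?w s p)\<^sup>2)" if p: "p \<in> ?S" for p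
  proof -
    have "1 / 5 \<le> (\<Sum>s<?q. 2 * ?w s p)"
      using final_states_far[OF assms p] hybrid_bound[OF _ unitary(2), of p "?f(p := 1)" ?f ?\<psi>]
      by (simp add: final_state_eq_evolve)
    then have "1 / 10 \<le> (\<Sum>s<?q. ?w s p)"
      by (simp flip: sum_distrib_left)
    then have "(1 / 10)\<^sup>2 \<le> (\<Sum>s<?q. ?w s p)\<^sup>2"
      by (intro power_mono) auto
    \<comment> \<open>Cauchy-Schwarz passes from norms to squared norms, which can be summed over
      the cells.\<close>
    also have "\<dots> \<le> real ?q * (\<Sum>s<?q. (?w s p)\<^sup>2)"
      using sum_squared_le_sum_of_squares[of "\<lambda>s. ?w s p" "{..<?q}"]
      by (simp add: mult.commute)
    finally show ?thesis
      by (simp add: power2_eq_square)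
  qed
  then have "(\<Sum>p\<in>?S. 1 / 100) \<le> (\<Sum>p\<in>?S. real ?q * (\<Sum>s<?q. (?w s p)\<^sup>2))"
    by (intro sum_mono)
  also have "\<dots> = real ?q * (\<Sum>s<?q. \<Sum>p\<in>?S. (?w s p)\<^sup>2)"
    by (subst sum.swap) (simp flip: sum_distrib_left)
  also have "\<dots> \<le> real ?q * (\<Sum>s<?q. 1)"
  proof (intro mult_left_mono sum_mono)
    fix s
    let ?\<chi> = "evolve n ?m ?f (take s ?Us) ?\<psi>"
    have "(\<Sum>p\<in>?S. (?w s p)\<^sup>2) \<le> (state_norm (basis n ?m) ?\<chi>)\<^sup>2"
      by (rule sum_cell_weights_le[OF strip_subset_grid[OF assms(2)]])
    also have "state_norm (basis n ?m) ?\<chi> = state_norm (basis n ?m) ?\<psi>"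
      using unitary(2) by (intro state_norm_evolve) (auto dest: in_set_takeD)
    \<comment> \<open>The norm of the start state is read off from that of the final state, as
      evolution preserves it.\<close>
    also have "\<dots> = 1"
      using state_norm_final_state[OF Q, of ?f] assms(1,2) unitary(2)
      by (simp add: final_state_eq_evolve state_norm_evolve)
    finally show "(\<Sum>p\<in>?S. (?w s p)\<^sup>2) \<le> 1"
      by simp
  qed simp
  finally have "real (n * d) \<le> (10 * real ?q)\<^sup>2"
    by (simp add: card_strip power2_eq_square)
  then have "sqrt (real (n * d)) \<le> 10 * real ?q"
    by (intro real_le_lsqrt) auto
  then show ?thesis
    by simp
qed

section \<open>The lower bounds\<close>

text \<open>An infinite value, or an empty set of algorithms, satisfies the bound trivially, so
  finite costs suffice. Rounding \<open>x\<close> up to a natural number moves the comparison into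
  \<open>enat\<close>, where the infimum is taken.\<close>

lemma ereal_le_INF_enat:
  assumes "\<And>a K. a \<in> S \<Longrightarrow> F a = enat K \<Longrightarrow> x \<le> real K"
  shows "ereal x \<le> ereal_of_enat (INF a\<in>S. F a)"
proof -
  have "enat (nat \<lceil>x\<rceil>) \<le> F a" if "a \<in> S" for a
    using assms[OF that] by (cases "F a") (auto simp: nat_le_iff ceiling_le_iff)
  then have "enat (nat \<lceil>x\<rceil>) \<le> (INF a\<in>S. F a)"
    by (rule INF_greatest)
  then have "ereal_of_enat (enat (nat \<lceil>x\<rceil>)) \<le> ereal_of_enat (INF a\<in>S. F a)"
    by (simp only: ereal_of_enat_le_iff)
  moreover have "ereal x \<le> ereal_of_enat (enat (nat \<lceil>x\<rceil>))"
    by (simp add: real_nat_ceiling_ge)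
  ultimately show ?thesis
    by (rule order.trans[rotated])
qed

lemma evaluations_le_of_SUP:
  assumes "(SUP f\<in>inputs n. enat (T * evaluations t f)) \<le> enat K" "1 \<le> T" "f \<in> inputs n"
  shows "evaluations t f \<le> K"
proof -
  have "enat (T * evaluations t f) \<le> enat K"
    using assms(1,3) by (auto simp: SUP_le_iff)
  moreover have "evaluations t f \<le> T * evaluations t f"
    using assms(2) by simp
  ultimately show ?thesis
    by (meson enat_ord_simps(1) order.trans)
qed

lemma randomized_query_complexity_ge:
  assumes "1 \<le> d" "d \<le> n" "1 \<le> T"
  shows "ereal (1 / 3 * real (n * d)) \<le> ereal_of_enat (randomized_query_complexity T n d)"
  unfolding randomized_query_complexity_def
proof (rule ereal_le_INF_enat)
  fix A K
  assume A: "A \<in> {A. randomized_solves n d A}"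
    and K: "(SUP t\<in>set_pmf A. SUP f\<in>inputs n. enat (T * evaluations t f)) = enat K"
  have "evaluations t (strip_input n d) \<le> K" if "t \<in> set_pmf A" for t
    using that K by (intro evaluations_le_of_SUP[OF _ assms(3) strip_input_in_inputs])
      (metis SUP_upper)
  then show "1 / 3 * real (n * d) \<le> real K"
    using A assms by (intro randomized_evaluations_ge) auto
qed

lemma deterministic_query_complexity_ge:
  assumes "1 \<le> d" "d \<le> n" "1 \<le> T"
  shows "ereal (1 / 3 * real (n * d)) \<le> ereal_of_enat (deterministic_query_complexity T n d)"
proof -
  \<comment> \<open>A decision tree, seen as a point distribution, keeps its worst-case
    cost.\<close>
  have "randomized_query_complexity T n d \<le> deterministic_query_complexity T n d"
    unfolding randomized_query_complexity_def deterministic_query_complexity_def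
    using deterministic_solves_imp_randomized_solves by (intro INF_mono) force
  then show ?thesis
    using randomized_query_complexity_ge[OF assms] ereal_of_enat_le_iff order.trans by blast
qed

lemma quantum_query_complexity_ge:
  assumes "1 \<le> d" "d \<le> n" "1 \<le> T"
  shows "ereal (1 / 10 * sqrt (real (n * d))) \<le> ereal_of_enat (quantum_query_complexity T n d)"
  unfolding quantum_query_complexity_def
proof (rule ereal_le_INF_enat)
  fix Q K
  assume "Q \<in> {Q. quantum_solves n d Q}" "enat (T * length (later_ops Q)) = enat K"
  moreover have "length (later_ops Q) \<le> T * length (later_ops Q)"
    using assms(3) by simp
  ultimately show "1 / 10 * sqrt (real (n * d)) \<le> real K"
    using quantum_queries_ge[OF assms(1,2), of Q] by simp
qed

theorem theorem7:
  fixes T :: "nat \<Rightarrow> nat"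
  assumes "\<forall>n. 1 \<le> T n"
    and "(\<lambda>n. real (T n)) \<in> O(\<lambda>n. 1)"
  shows
    "(\<exists>c>0. \<forall>n d. 1 \<le> d \<and> d \<le> n \<longrightarrow>
        ereal (c * real (n * d)) \<le> ereal_of_enat (deterministic_query_complexity (T n) n d)) \<and>
     (\<exists>c>0. \<forall>n d. 1 \<le> d \<and> d \<le> n \<longrightarrow>
        ereal (c * real (n * d)) \<le> ereal_of_enat (randomized_query_complexity (T n) n d)) \<and>
     (\<exists>c>0. \<forall>n d. 1 \<le> d \<and> d \<le> n \<longrightarrow>
        ereal (c * sqrt (real (n * d))) \<le> ereal_of_enat (quantum_query_complexity (T n) n d))"
proof (intro conjI)
  \<comment> \<open>Since \<open>1 \<le> T n\<close>, bounds on evaluations are bounds on charged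
    queries with the same constant.\<close>
  show "\<exists>c>0. \<forall>n d. 1 \<le> d \<and> d \<le> n \<longrightarrow>
      ereal (c * real (n * d)) \<le> ereal_of_enat (deterministic_query_complexity (T n) n d)"
    using assms(1) by (intro exI[of _ "1 / 3"] conjI allI impI deterministic_query_complexity_ge) auto
  show "\<exists>c>0. \<forall>n d. 1 \<le> d \<and> d \<le> n \<longrightarrow>
      ereal (c * real (n * d)) \<le> ereal_of_enat (randomized_query_complexity (T n) n d)"
    using assms(1) by (intro exI[of _ "1 / 3"] conjI allI impI randomized_query_complexity_ge) auto
  show "\<exists>c>0. \<forall>n d. 1 \<le> d \<and> d \<le> n \<longrightarrow>
      ereal (c * sqrt (real (n * d))) \<le> ereal_of_enat (quantum_query_complexity (T n) n d)"
    using assms(1) by (intro exI[of _ "1 / 10"] conjI allI impI quantum_query_complexity_ge) auto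
qed

end
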